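(* Let $(Q,\cdot)$ be a loop. 1. Let $H$ be a subgroup of ${}_1N^A_l$ and let ${}_1\theta^A_l$ be the corresponding equivalence on $Q$. (a) If ${}_1\theta^A_l$ is admissible relative to every left translation $L_x$ of $(Q,\cdot)$ and its inverse, then ${}_1\theta^A_l$ is a normal congruence of $(Q,\cdot)$. (b) If ${}_1\theta^A_l$ is admissible relative to every middle translation $P_x$ of $(Q,\cdot)$ and its inverse, then ${}_1\theta^A_l$ is a normal congruence of $(Q,\cdot)$. 2. Let $H$ be a subgroup of ${}_2N^A_r$ and let ${}_2\theta^A_r$ be the corresponding equivalence on $Q$. (a) If ${}_2\theta^A_r$ is admissible relative to every right translation $R_x$ of $(Q,\cdot)$ and its inverse, then ${}_2\theta^A_r$ is a normal congruence of $(Q,\cdot)$. (b) If ${}_2\theta^A_r$ is admissible relative to every middle translation $P_x$ of $(Q,\cdot)$ and its inverse, then ${}_2\theta^A_r$ is a normal congruence of $(Q,\cdot)$. 3. Let $H$ be a subgroup of ${}_1N^A_m\cap{}_2N^A_m$ and let ${}_1\theta^A_m$ be the corresponding equivalence on $Q$. (a) If ${}_1\theta^A_m$ is admissible relative to every right translation $R_x$ of $(Q,\cdot)$ and its inverse, then ${}_1\theta^A_m$ is a normal congruence of $(Q,\cdot)$. (b) If ${}_1\theta^A_m$ is admissible relative to every left translation $L_x$ of $(Q,\cdot)$ and its inverse, then ${}_1\theta^A_m$ is a normal congruence of $(Q,\cdot)$.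
   Context: A loop is a quasigroup (a non-empty set with a binary operation for which $x\cdot a=b$ and $a\cdot y=b$ are uniquely solvable) with a two-sided identity element. Translations: $L_ax=a\cdot x$, $R_ax=x\cdot a$, and $P_a$ defined by $x\cdot P_ax=a$. $\varepsilon$ is the identity permutation of $Q$. An autotopy is a triple $(\alpha,\beta,\gamma)$ of permutations of $Q$ with $\alpha x\cdot\beta y=\gamma(x\cdot y)$ for all $x,y$. $N^A_l,N^A_r,N^A_m$ are the groups of autotopies of the forms $(\alpha,\varepsilon,\gamma)$, $(\varepsilon,\beta,\gamma)$, $(\alpha,\beta,\varepsilon)$ respectively; ${}_iN^A_l$, ${}_iN^A_r$, ${}_iN^A_m$ is the group of $i$-th components of their elements (a subgroup of the symmetric group on $Q$). The equivalence corresponding to a permutation group $H$ on $Q$ is the one whose classes are the orbits of $H$: $a\,\theta\,b$ iff $b=\alpha a$ for some $\alpha\in H$. An equivalence $\theta$ is admissible relative to a permutation $\alpha$ if $x\,\theta\,y$ implies $\alpha x\,\theta\,\alpha y$ and $\alpha^{-1}x\,\theta\,\alpha^{-1}y$. A normal congruence is an equivalence $\theta$ such that for all $x,y,z$: $x\,\theta\,y\Leftrightarrow(z\cdot x)\,\theta\,(z\cdot y)$ and $x\,\theta\,y\Leftrightarrow(x\cdot z)\,\theta\,(y\cdot z)$. *)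

theory Defs
  imports "HOL-Algebra.Bij"
begin

definition is_quasigroup :: "'a set \<Rightarrow> ('a \<Rightarrow> 'a \<Rightarrow> 'a) \<Rightarrow> bool" where
  "is_quasigroup Q mul \<longleftrightarrow>
     Q \<noteq> {} \<and>
     (\<forall>x\<in>Q. \<forall>y\<in>Q. mul x y \<in> Q) \<and>
     (\<forall>a\<in>Q. \<forall>b\<in>Q. \<exists>!x. x \<in> Q \<and> mul x a = b) \<and>
     (\<forall>a\<in>Q. \<forall>b\<in>Q. \<exists>!y. y \<in> Q \<and> mul a y = b)"

definition is_loop :: "'a set \<Rightarrow> ('a \<Rightarrow> 'a \<Rightarrow> 'a) \<Rightarrow> bool" where
  "is_loop Q mul \<longleftrightarrow>
     is_quasigroup Q mul \<and> (\<exists>e\<in>Q. \<forall>x\<in>Q. mul e x = x \<and> mul x e = x)"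

text \<open>Permutations of \<open>Q\<close> are the elements of \<open>Bij Q\<close>, the carrier of the symmetric group
  \<open>BijGroup Q\<close>. They are extensional (\<open>undefined\<close> outside \<open>Q\<close>), so that equality of
  permutations is equality of functions; hence the translations are restricted to \<open>Q\<close>.\<close>

definition left_trans :: "'a set \<Rightarrow> ('a \<Rightarrow> 'a \<Rightarrow> 'a) \<Rightarrow> 'a \<Rightarrow> 'a \<Rightarrow> 'a" where
  "left_trans Q mul a = (\<lambda>x\<in>Q. mul a x)"

definition right_trans :: "'a set \<Rightarrow> ('a \<Rightarrow> 'a \<Rightarrow> 'a) \<Rightarrow> 'a \<Rightarrow> 'a \<Rightarrow> 'a" where
  "right_trans Q mul a = (\<lambda>x\<in>Q. mul x a)"

text \<open>The defining equation of the middle translation \<open>P\<^sub>a\<close> is \<open>x \<cdot> P\<^sub>a x = a\<close>. The lemmas below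
  show that all translations are permutations of \<open>Q\<close>, so their inverses in \<open>BijGroup Q\<close> are
  meaningful.\<close>

definition middle_trans :: "'a set \<Rightarrow> ('a \<Rightarrow> 'a \<Rightarrow> 'a) \<Rightarrow> 'a \<Rightarrow> 'a \<Rightarrow> 'a" where
  "middle_trans Q mul a = (\<lambda>x\<in>Q. THE y. y \<in> Q \<and> mul x y = a)"

lemma left_trans_Bij:
  assumes Q: "is_quasigroup Q mul" and a: "a \<in> Q"
  shows "left_trans Q mul a \<in> Bij Q"
proof -
  have c: "mul a x \<in> Q" if "x \<in> Q" for x
    using Q a that by (simp add: is_quasigroup_def)
  have u: "\<exists>!x. x \<in> Q \<and> mul a x = b" if "b \<in> Q" for b
    using Q a that by (simp add: is_quasigroup_def)
  have "inj_on (left_trans Q mul a) Q"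
  proof (rule inj_onI)
    fix x y assume h: "x \<in> Q" "y \<in> Q" "left_trans Q mul a x = left_trans Q mul a y"
    then have "mul a x = mul a y" by (simp add: left_trans_def)
    with u[OF c[OF h(1)]] h(1,2) show "x = y" by auto
  qed
  moreover have "left_trans Q mul a ` Q = Q"
  proof (intro equalityI subsetI)
    fix b assume "b \<in> left_trans Q mul a ` Q"
    then show "b \<in> Q" using c by (auto simp: left_trans_def)
  next
    fix b assume "b \<in> Q"
    then obtain x where "x \<in> Q" "mul a x = b" using u by blast
    then show "b \<in> left_trans Q mul a ` Q" by (force simp: left_trans_def)
  qed
  ultimately show ?thesis
    by (simp add: Bij_def bij_betw_def left_trans_def)
qed

lemma right_trans_Bij:
  assumes Q: "is_quasigroup Q mul" and a: "a \<in> Q"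
  shows "right_trans Q mul a \<in> Bij Q"
proof -
  have c: "mul x a \<in> Q" if "x \<in> Q" for x
    using Q a that by (simp add: is_quasigroup_def)
  have u: "\<exists>!x. x \<in> Q \<and> mul x a = b" if "b \<in> Q" for b
    using Q a that by (simp add: is_quasigroup_def)
  have "inj_on (right_trans Q mul a) Q"
  proof (rule inj_onI)
    fix x y assume h: "x \<in> Q" "y \<in> Q" "right_trans Q mul a x = right_trans Q mul a y"
    then have "mul x a = mul y a" by (simp add: right_trans_def)
    with u[OF c[OF h(1)]] h(1,2) show "x = y" by auto
  qed
  moreover have "right_trans Q mul a ` Q = Q"
  proof (intro equalityI subsetI)
    fix b assume "b \<in> right_trans Q mul a ` Q"
    then show "b \<in> Q" using c by (auto simp: right_trans_def)
  next
    fix b assume "b \<in> Q"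
    then obtain x where "x \<in> Q" "mul x a = b" using u by blast
    then show "b \<in> right_trans Q mul a ` Q" by (force simp: right_trans_def)
  qed
  ultimately show ?thesis
    by (simp add: Bij_def bij_betw_def right_trans_def)
qed

lemma middle_trans_eq:
  assumes "is_quasigroup Q mul" "a \<in> Q" "x \<in> Q"
  shows "middle_trans Q mul a x \<in> Q \<and> mul x (middle_trans Q mul a x) = a"
proof -
  have "\<exists>!y. y \<in> Q \<and> mul x y = a"
    using assms by (simp add: is_quasigroup_def)
  from theI'[OF this] show ?thesis
    using assms(3) by (simp add: middle_trans_def)
qed

lemma middle_trans_Bij:
  assumes Q: "is_quasigroup Q mul" and a: "a \<in> Q"
  shows "middle_trans Q mul a \<in> Bij Q"
proof -
  let ?P = "middle_trans Q mul a"
  note P = middle_trans_eq[OF Q a]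
  have "inj_on ?P Q"
  proof (rule inj_onI)
    fix x x' assume h: "x \<in> Q" "x' \<in> Q" "?P x = ?P x'"
    have "\<exists>!z. z \<in> Q \<and> mul z (?P x) = a"
      using Q a P[OF h(1)] by (simp add: is_quasigroup_def)
    then show "x = x'" using P[OF h(1)] P[OF h(2)] h by auto
  qed
  moreover have "y \<in> ?P ` Q" if y: "y \<in> Q" for y
  proof -
    have "\<exists>!x. x \<in> Q \<and> mul x y = a"
      using Q a y by (simp add: is_quasigroup_def)
    then obtain x where x: "x \<in> Q" "mul x y = a" by blast
    have "\<exists>!z. z \<in> Q \<and> mul x z = a"
      using Q a x by (simp add: is_quasigroup_def)
    then have "?P x = y" using P[OF x(1)] x y by auto
    then show ?thesis using x(1) by blast
  qed
  ultimately show ?thesis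
    using middle_trans_eq[OF Q a]
    by (auto simp: Bij_def bij_betw_def middle_trans_def)
qed

definition autotopies ::
    "'a set \<Rightarrow> ('a \<Rightarrow> 'a \<Rightarrow> 'a) \<Rightarrow> (('a \<Rightarrow> 'a) \<times> ('a \<Rightarrow> 'a) \<times> ('a \<Rightarrow> 'a)) set" where
  "autotopies Q mul =
     {(\<alpha>, \<beta>, \<gamma>). \<alpha> \<in> Bij Q \<and> \<beta> \<in> Bij Q \<and> \<gamma> \<in> Bij Q \<and>
        (\<forall>x\<in>Q. \<forall>y\<in>Q. mul (\<alpha> x) (\<beta> y) = \<gamma> (mul x y))}"

definition nucleus_l ::
    "'a set \<Rightarrow> ('a \<Rightarrow> 'a \<Rightarrow> 'a) \<Rightarrow> (('a \<Rightarrow> 'a) \<times> ('a \<Rightarrow> 'a) \<times> ('a \<Rightarrow> 'a)) set" where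
  "nucleus_l Q mul = {(\<alpha>, \<beta>, \<gamma>) \<in> autotopies Q mul. \<beta> = \<one>\<^bsub>BijGroup Q\<^esub>}"

definition nucleus_r ::
    "'a set \<Rightarrow> ('a \<Rightarrow> 'a \<Rightarrow> 'a) \<Rightarrow> (('a \<Rightarrow> 'a) \<times> ('a \<Rightarrow> 'a) \<times> ('a \<Rightarrow> 'a)) set" where
  "nucleus_r Q mul = {(\<alpha>, \<beta>, \<gamma>) \<in> autotopies Q mul. \<alpha> = \<one>\<^bsub>BijGroup Q\<^esub>}"

definition nucleus_m ::
    "'a set \<Rightarrow> ('a \<Rightarrow> 'a \<Rightarrow> 'a) \<Rightarrow> (('a \<Rightarrow> 'a) \<times> ('a \<Rightarrow> 'a) \<times> ('a \<Rightarrow> 'a)) set" where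
  "nucleus_m Q mul = {(\<alpha>, \<beta>, \<gamma>) \<in> autotopies Q mul. \<gamma> = \<one>\<^bsub>BijGroup Q\<^esub>}"

definition comp1 :: "('p \<times> 'p \<times> 'p) set \<Rightarrow> 'p set" where
  "comp1 N = (\<lambda>(\<alpha>, \<beta>, \<gamma>). \<alpha>) ` N"

definition comp2 :: "('p \<times> 'p \<times> 'p) set \<Rightarrow> 'p set" where
  "comp2 N = (\<lambda>(\<alpha>, \<beta>, \<gamma>). \<beta>) ` N"

definition orbit_equiv :: "'a set \<Rightarrow> ('a \<Rightarrow> 'a) set \<Rightarrow> ('a \<times> 'a) set" where
  "orbit_equiv Q H = {(a, b). a \<in> Q \<and> b \<in> Q \<and> (\<exists>\<alpha>\<in>H. b = \<alpha> a)}"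

definition admissible :: "'a set \<Rightarrow> ('a \<times> 'a) set \<Rightarrow> ('a \<Rightarrow> 'a) \<Rightarrow> bool" where
  "admissible Q \<theta> \<alpha> \<longleftrightarrow>
     (\<forall>x\<in>Q. \<forall>y\<in>Q. (x, y) \<in> \<theta> \<longrightarrow>
        (\<alpha> x, \<alpha> y) \<in> \<theta> \<and> ((inv\<^bsub>BijGroup Q\<^esub> \<alpha>) x, (inv\<^bsub>BijGroup Q\<^esub> \<alpha>) y) \<in> \<theta>)"

definition normal_congruence ::
    "'a set \<Rightarrow> ('a \<Rightarrow> 'a \<Rightarrow> 'a) \<Rightarrow> ('a \<times> 'a) set \<Rightarrow> bool" where
  "normal_congruence Q mul \<theta> \<longleftrightarrow>
     equiv Q \<theta> \<and>
     (\<forall>x\<in>Q. \<forall>y\<in>Q. \<forall>z\<in>Q.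
        ((x, y) \<in> \<theta> \<longleftrightarrow> (mul z x, mul z y) \<in> \<theta>) \<and>
        ((x, y) \<in> \<theta> \<longleftrightarrow> (mul x z, mul y z) \<in> \<theta>))"

end

theory Submission
  imports Defs
begin

text \<open>
  Write \<open>\<theta>\<close> for the orbit equivalence of \<open>H\<close>. For any permutation \<open>f\<close>, admissibility of \<open>\<theta>\<close>
  relative to \<open>f\<close> says that \<open>x \<theta> y\<close> and \<open>f x \<theta> f y\<close> are equivalent. Thus admissibility relative to
  all right (left) translations is exactly one half of the definition of a normal congruence, and
  admissibility relative to all middle translations says that \<open>x \<theta> y \<longleftrightarrow> u \<theta> v\<close> whenever
  \<open>x \<cdot> u = y \<cdot> v\<close>. Each half of normality has to come from the form of \<open>H\<close>, from the
  admissibility hypothesis, or from the other half.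

  In a loop, the members \<open>\<alpha>\<close> of the first component of the left nucleus satisfy
  \<open>\<alpha> x \<cdot> y = \<alpha> (x \<cdot> y)\<close>; this makes \<open>\<theta>\<close> invariant under right multiplication and settles the case of
  left translations. For middle translations, solve \<open>z' \<cdot> x = z \<cdot> y\<close> for \<open>z'\<close>: the middle
  translations give \<open>x \<theta> y \<longleftrightarrow> z' \<theta> z\<close>, and right invariance gives
  \<open>z' \<theta> z \<longleftrightarrow> z' \<cdot> x \<theta> z \<cdot> x\<close>, that is, \<open>z \<cdot> y \<theta> z \<cdot> x\<close>. The right nucleus is the left
  nucleus of the opposite loop.

  A permutation \<open>\<alpha>\<close> that is both a first and a second component of the middle nucleus satisfies
  \<open>\<alpha> x \<cdot> y = x \<cdot> \<alpha> y\<close> (it is multiplication, on either side, by \<open>\<alpha> e\<close>). With \<open>z'\<close> as above,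
  right invariance turns \<open>z \<cdot> x \<theta> z \<cdot> y\<close> into \<open>z' = \<alpha> z\<close> for some \<open>\<alpha> \<in> H\<close>, and
  \<open>z \<cdot> y = \<alpha> z \<cdot> x = z \<cdot> \<alpha> x\<close> is the same as \<open>y = \<alpha> x\<close>.
\<close>

section \<open>Opposite quasigroups and invariant equivalences\<close>

lemma quasigroup_opposite:
  "is_quasigroup Q mul \<Longrightarrow> is_quasigroup Q (\<lambda>x y. mul y x)"
  by (simp add: is_quasigroup_def)

lemma quasigroup_closed:
  "is_quasigroup Q mul \<Longrightarrow> x \<in> Q \<Longrightarrow> y \<in> Q \<Longrightarrow> mul x y \<in> Q"
  by (simp add: is_quasigroup_def)

lemma quasigroup_left_division:
  assumes "is_quasigroup Q mul" "a \<in> Q" "b \<in> Q"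
  obtains y where "y \<in> Q" "mul a y = b"
proof -
  have "\<exists>!y. y \<in> Q \<and> mul a y = b" using assms by (simp add: is_quasigroup_def)
  then show thesis using that by blast
qed

lemma quasigroup_right_division:
  assumes "is_quasigroup Q mul" "a \<in> Q" "b \<in> Q"
  obtains x where "x \<in> Q" "mul x a = b"
  using quasigroup_left_division[OF quasigroup_opposite[OF assms(1)] assms(2,3)] .

lemma quasigroup_left_cancel:
  assumes "is_quasigroup Q mul" "a \<in> Q" "x \<in> Q" "y \<in> Q" "mul a x = mul a y"
  shows "x = y"
proof -
  have "\<exists>!z. z \<in> Q \<and> mul a z = mul a y" using assms by (simp add: is_quasigroup_def)
  then show ?thesis using assms(3-5) by blast
qed

lemma quasigroup_right_cancel:
  assumes "is_quasigroup Q mul" "a \<in> Q" "x \<in> Q" "y \<in> Q" "mul x a = mul y a"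
  shows "x = y"
  using quasigroup_left_cancel[OF quasigroup_opposite[OF assms(1)] assms(2-5)] .

text \<open>Invariance under right multiplication, including cancellation. Invariance under left
  multiplication is this notion for the opposite operation.\<close>

definition right_invariant :: "'a set \<Rightarrow> ('a \<Rightarrow> 'a \<Rightarrow> 'a) \<Rightarrow> ('a \<times> 'a) set \<Rightarrow> bool" where
  "right_invariant Q mul \<theta> \<longleftrightarrow>
     (\<forall>x\<in>Q. \<forall>y\<in>Q. \<forall>z\<in>Q. (x, y) \<in> \<theta> \<longleftrightarrow> (mul x z, mul y z) \<in> \<theta>)"

text \<open>The effect of admissibility relative to all middle translations, stated without
  reference to them. The notion is symmetric under passing to the opposite operation.\<close>

definition division_invariant :: "'a set \<Rightarrow> ('a \<Rightarrow> 'a \<Rightarrow> 'a) \<Rightarrow> ('a \<times> 'a) set \<Rightarrow> bool" where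
  "division_invariant Q mul \<theta> \<longleftrightarrow>
     (\<forall>x\<in>Q. \<forall>y\<in>Q. \<forall>u\<in>Q. \<forall>v\<in>Q. mul x u = mul y v \<longrightarrow> ((x, y) \<in> \<theta> \<longleftrightarrow> (u, v) \<in> \<theta>))"

lemma division_invariant_opposite:
  "division_invariant Q mul \<theta> \<Longrightarrow> division_invariant Q (\<lambda>x y. mul y x) \<theta>"
  unfolding division_invariant_def by blast

lemma normal_congruence_iff:
  "normal_congruence Q mul \<theta> \<longleftrightarrow>
     equiv Q \<theta> \<and> right_invariant Q mul \<theta> \<and> right_invariant Q (\<lambda>x y. mul y x) \<theta>"
  unfolding normal_congruence_def right_invariant_def by blast

lemma left_invariant_if_division_invariant:
  assumes Q: "is_quasigroup Q mul" and eq: "equiv Q \<theta>"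
    and r: "right_invariant Q mul \<theta>" and d: "division_invariant Q mul \<theta>"
  shows "right_invariant Q (\<lambda>x y. mul y x) \<theta>"
  unfolding right_invariant_def
proof (intro ballI)
  fix x y z assume xyz: "x \<in> Q" "y \<in> Q" "z \<in> Q"
  then obtain z' where z': "z' \<in> Q" "mul z' x = mul z y"
    using Q quasigroup_closed quasigroup_right_division by metis
  have sym: "sym \<theta>" using eq by (simp add: equiv_def)
  have "(x, y) \<in> \<theta> \<longleftrightarrow> (z', z) \<in> \<theta>"
    using d xyz z' unfolding division_invariant_def by blast
  also have "\<dots> \<longleftrightarrow> (mul z' x, mul z x) \<in> \<theta>"
    using r xyz z' unfolding right_invariant_def by blast
  also have "\<dots> \<longleftrightarrow> (mul z x, mul z y) \<in> \<theta>"
    using sym z' by (auto dest: symD)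
  finally show "(x, y) \<in> \<theta> \<longleftrightarrow> (mul z x, mul z y) \<in> \<theta>" .
qed

section \<open>Admissibility relative to translations\<close>

lemma admissible_iff:
  assumes f: "f \<in> Bij Q" and adm: "admissible Q \<theta> f" and "x \<in> Q" "y \<in> Q"
  shows "(x, y) \<in> \<theta> \<longleftrightarrow> (f x, f y) \<in> \<theta>"
proof
  show "(x, y) \<in> \<theta> \<Longrightarrow> (f x, f y) \<in> \<theta>"
    using assms by (simp add: admissible_def)
next
  assume h: "(f x, f y) \<in> \<theta>"
  have bij: "bij_betw f Q Q" using f by (simp add: Bij_def)
  have "f x \<in> Q" "f y \<in> Q" using bij assms(3,4) bij_betwE by blast+
  moreover have "inv_into Q f (f x) = x" "inv_into Q f (f y) = y"
    using bij assms(3,4) by (simp_all add: bij_betw_inv_into_left)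
  ultimately show "(x, y) \<in> \<theta>"
    using adm h unfolding admissible_def inv_BijGroup[OF f] by (metis restrict_apply')
qed

lemma right_invariant_if_admissible:
  assumes "is_quasigroup Q mul" "\<forall>a\<in>Q. admissible Q \<theta> (right_trans Q mul a)"
  shows "right_invariant Q mul \<theta>"
  unfolding right_invariant_def
proof (intro ballI)
  fix x y z assume xyz: "x \<in> Q" "y \<in> Q" "z \<in> Q"
  then have "admissible Q \<theta> (right_trans Q mul z)" using assms(2) by blast
  from admissible_iff[OF right_trans_Bij[OF assms(1) xyz(3)] this xyz(1,2)]
  show "(x, y) \<in> \<theta> \<longleftrightarrow> (mul x z, mul y z) \<in> \<theta>"
    using xyz by (simp add: right_trans_def)
qed

lemma left_invariant_if_admissible:
  assumes "is_quasigroup Q mul" "\<forall>a\<in>Q. admissible Q \<theta> (left_trans Q mul a)"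
  shows "right_invariant Q (\<lambda>x y. mul y x) \<theta>"
  unfolding right_invariant_def
proof (intro ballI)
  fix x y z assume xyz: "x \<in> Q" "y \<in> Q" "z \<in> Q"
  then have "admissible Q \<theta> (left_trans Q mul z)" using assms(2) by blast
  from admissible_iff[OF left_trans_Bij[OF assms(1) xyz(3)] this xyz(1,2)]
  show "(x, y) \<in> \<theta> \<longleftrightarrow> (mul z x, mul z y) \<in> \<theta>"
    using xyz by (simp add: left_trans_def)
qed

lemma division_invariant_if_admissible:
  assumes Q: "is_quasigroup Q mul" and adm: "\<forall>a\<in>Q. admissible Q \<theta> (middle_trans Q mul a)"
  shows "division_invariant Q mul \<theta>"
  unfolding division_invariant_def
proof (intro ballI impI)
  fix x y u v assume h: "x \<in> Q" "y \<in> Q" "u \<in> Q" "v \<in> Q" "mul x u = mul y v"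
  let ?P = "middle_trans Q mul (mul x u)"
  have a: "mul x u \<in> Q" using Q h quasigroup_closed by metis
  have "?P x = u" "?P y = v"
    using middle_trans_eq[OF Q a] quasigroup_left_cancel[OF Q] h by metis+
  then show "(x, y) \<in> \<theta> \<longleftrightarrow> (u, v) \<in> \<theta>"
    using admissible_iff[OF middle_trans_Bij[OF Q a]] adm a h by metis
qed

section \<open>Autotopies and the component groups of the nuclei\<close>

lemma one_BijGroup_apply: "x \<in> Q \<Longrightarrow> \<one>\<^bsub>BijGroup Q\<^esub> x = x"
  by (simp add: BijGroup_def)

lemma mult_BijGroup_apply:
  "f \<in> Bij Q \<Longrightarrow> g \<in> Bij Q \<Longrightarrow> x \<in> Q \<Longrightarrow> (f \<otimes>\<^bsub>BijGroup Q\<^esub> g) x = f (g x)"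
  by (simp add: BijGroup_def compose_def)

lemma carrier_BijGroup: "carrier (BijGroup Q) = Bij Q"
  by (simp add: BijGroup_def)

lemma Bij_closed: "f \<in> Bij Q \<Longrightarrow> x \<in> Q \<Longrightarrow> f x \<in> Q"
  by (auto simp: Bij_def bij_betw_def)

lemma inv_BijGroup_mem: "f \<in> Bij Q \<Longrightarrow> inv\<^bsub>BijGroup Q\<^esub> f \<in> Bij Q"
  using group.inv_closed[OF group_BijGroup] carrier_BijGroup by metis

lemma BijGroup_apply_inv:
  "f \<in> Bij Q \<Longrightarrow> x \<in> Q \<Longrightarrow> f ((inv\<^bsub>BijGroup Q\<^esub> f) x) = x"
  by (metis mult_BijGroup_apply inv_BijGroup_mem one_BijGroup_apply
      group.r_inv[OF group_BijGroup] carrier_BijGroup)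

lemma BijGroup_inv_apply:
  "f \<in> Bij Q \<Longrightarrow> x \<in> Q \<Longrightarrow> (inv\<^bsub>BijGroup Q\<^esub> f) (f x) = x"
  by (metis mult_BijGroup_apply inv_BijGroup_mem one_BijGroup_apply
      group.l_inv[OF group_BijGroup] carrier_BijGroup)

lemma autotopies_one:
  assumes "is_quasigroup Q mul"
  shows "(\<one>\<^bsub>BijGroup Q\<^esub>, \<one>\<^bsub>BijGroup Q\<^esub>, \<one>\<^bsub>BijGroup Q\<^esub>) \<in> autotopies Q mul"
proof -
  have "\<one>\<^bsub>BijGroup Q\<^esub> \<in> Bij Q"
    using monoid.one_closed[OF group.is_monoid[OF group_BijGroup]] carrier_BijGroup by metis
  then show ?thesis
    using assms by (simp add: autotopies_def one_BijGroup_apply quasigroup_closed)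
qed

lemma autotopies_mult:
  assumes Q: "is_quasigroup Q mul"
    and "(\<alpha>, \<beta>, \<gamma>) \<in> autotopies Q mul" "(\<alpha>', \<beta>', \<gamma>') \<in> autotopies Q mul"
  shows "(\<alpha> \<otimes>\<^bsub>BijGroup Q\<^esub> \<alpha>', \<beta> \<otimes>\<^bsub>BijGroup Q\<^esub> \<beta>', \<gamma> \<otimes>\<^bsub>BijGroup Q\<^esub> \<gamma>') \<in> autotopies Q mul"
proof -
  have "f \<otimes>\<^bsub>BijGroup Q\<^esub> g \<in> Bij Q" if "f \<in> Bij Q" "g \<in> Bij Q" for f g
    using that monoid.m_closed[OF group.is_monoid[OF group_BijGroup]] carrier_BijGroup by metis
  then show ?thesis
    using assms(2,3)
    by (simp add: autotopies_def mult_BijGroup_apply Bij_closed quasigroup_closed[OF Q])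
qed

lemma autotopies_inv:
  assumes Q: "is_quasigroup Q mul" and "(\<alpha>, \<beta>, \<gamma>) \<in> autotopies Q mul"
  shows "(inv\<^bsub>BijGroup Q\<^esub> \<alpha>, inv\<^bsub>BijGroup Q\<^esub> \<beta>, inv\<^bsub>BijGroup Q\<^esub> \<gamma>) \<in> autotopies Q mul"
proof -
  have B: "\<alpha> \<in> Bij Q" "\<beta> \<in> Bij Q" "\<gamma> \<in> Bij Q"
    and aut: "\<And>x y. x \<in> Q \<Longrightarrow> y \<in> Q \<Longrightarrow> mul (\<alpha> x) (\<beta> y) = \<gamma> (mul x y)"
    using assms(2) by (auto simp: autotopies_def)
  note BI = B[THEN inv_BijGroup_mem]
  have "mul ((inv\<^bsub>BijGroup Q\<^esub> \<alpha>) x) ((inv\<^bsub>BijGroup Q\<^esub> \<beta>) y) = (inv\<^bsub>BijGroup Q\<^esub> \<gamma>) (mul x y)"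
    if xy: "x \<in> Q" "y \<in> Q" for x y
  proof -
    have c: "(inv\<^bsub>BijGroup Q\<^esub> \<alpha>) x \<in> Q" "(inv\<^bsub>BijGroup Q\<^esub> \<beta>) y \<in> Q"
      using Bij_closed BI xy by metis+
    have "mul x y = \<gamma> (mul ((inv\<^bsub>BijGroup Q\<^esub> \<alpha>) x) ((inv\<^bsub>BijGroup Q\<^esub> \<beta>) y))"
      using aut[OF c] BijGroup_apply_inv B xy by metis
    then show ?thesis
      using BijGroup_inv_apply[OF B(3) quasigroup_closed[OF Q c]] by metis
  qed
  then show ?thesis using BI by (simp add: autotopies_def)
qed

lemma subgroup_BijGroupI:
  assumes "K \<subseteq> Bij Q" "\<one>\<^bsub>BijGroup Q\<^esub> \<in> K"
    and "\<And>f g. f \<in> K \<Longrightarrow> g \<in> K \<Longrightarrow> f \<otimes>\<^bsub>BijGroup Q\<^esub> g \<in> K"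
    and "\<And>f. f \<in> K \<Longrightarrow> inv\<^bsub>BijGroup Q\<^esub> f \<in> K"
  shows "subgroup K (BijGroup Q)"
  using assms by (intro subgroup.intro) (auto simp: carrier_BijGroup)

lemma
  one_mult_one_BijGroup: "\<one>\<^bsub>BijGroup Q\<^esub> \<otimes>\<^bsub>BijGroup Q\<^esub> \<one>\<^bsub>BijGroup Q\<^esub> = \<one>\<^bsub>BijGroup Q\<^esub>" and
  inv_one_BijGroup: "inv\<^bsub>BijGroup Q\<^esub> \<one>\<^bsub>BijGroup Q\<^esub> = \<one>\<^bsub>BijGroup Q\<^esub>"
proof -
  interpret group "BijGroup Q" by (rule group_BijGroup)
  show "\<one>\<^bsub>BijGroup Q\<^esub> \<otimes>\<^bsub>BijGroup Q\<^esub> \<one>\<^bsub>BijGroup Q\<^esub> = \<one>\<^bsub>BijGroup Q\<^esub>"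
    and "inv\<^bsub>BijGroup Q\<^esub> \<one>\<^bsub>BijGroup Q\<^esub> = \<one>\<^bsub>BijGroup Q\<^esub>" by simp_all
qed

lemma mem_comp1_iff: "\<alpha> \<in> comp1 N \<longleftrightarrow> (\<exists>\<beta> \<gamma>. (\<alpha>, \<beta>, \<gamma>) \<in> N)"
  by (force simp: comp1_def)

lemma mem_comp2_iff: "\<beta> \<in> comp2 N \<longleftrightarrow> (\<exists>\<alpha> \<gamma>. (\<alpha>, \<beta>, \<gamma>) \<in> N)"
  by (force simp: comp2_def)

lemma mem_comp1_nucleus_l:
  "\<alpha> \<in> comp1 (nucleus_l Q mul) \<longleftrightarrow> (\<exists>\<gamma>. (\<alpha>, \<one>\<^bsub>BijGroup Q\<^esub>, \<gamma>) \<in> autotopies Q mul)"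
  by (auto simp: mem_comp1_iff nucleus_l_def)

lemma mem_comp1_nucleus_m:
  "\<alpha> \<in> comp1 (nucleus_m Q mul) \<longleftrightarrow> (\<exists>\<beta>. (\<alpha>, \<beta>, \<one>\<^bsub>BijGroup Q\<^esub>) \<in> autotopies Q mul)"
  by (auto simp: mem_comp1_iff nucleus_m_def)

lemma autotopies_opposite:
  "(\<beta>, \<alpha>, \<gamma>) \<in> autotopies Q (\<lambda>x y. mul y x) \<longleftrightarrow> (\<alpha>, \<beta>, \<gamma>) \<in> autotopies Q mul"
  by (auto simp: autotopies_def)

text \<open>Passing to the opposite loop exchanges the first two components of an autotopy. This reduces
  the right nucleus to the left one, and second components to first components.\<close>

lemma comp2_nucleus_r_eq: "comp2 (nucleus_r Q mul) = comp1 (nucleus_l Q (\<lambda>x y. mul y x))"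
  by (auto simp: mem_comp1_iff mem_comp2_iff nucleus_l_def nucleus_r_def
      autotopies_opposite[where mul = mul])

lemma comp2_nucleus_m_eq: "comp2 (nucleus_m Q mul) = comp1 (nucleus_m Q (\<lambda>x y. mul y x))"
  by (auto simp: mem_comp1_iff mem_comp2_iff nucleus_m_def
      autotopies_opposite[where mul = mul])

lemma subgroup_comp1_nucleus_l:
  assumes Q: "is_quasigroup Q mul"
  shows "subgroup (comp1 (nucleus_l Q mul)) (BijGroup Q)"
proof (rule subgroup_BijGroupI)
  show "comp1 (nucleus_l Q mul) \<subseteq> Bij Q"
    by (auto simp: mem_comp1_nucleus_l autotopies_def)
  show "\<one>\<^bsub>BijGroup Q\<^esub> \<in> comp1 (nucleus_l Q mul)"
    using autotopies_one[OF Q] by (auto simp: mem_comp1_nucleus_l)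
  show "f \<otimes>\<^bsub>BijGroup Q\<^esub> g \<in> comp1 (nucleus_l Q mul)"
    if "f \<in> comp1 (nucleus_l Q mul)" "g \<in> comp1 (nucleus_l Q mul)" for f g
    using that autotopies_mult[OF Q] one_mult_one_BijGroup
    unfolding mem_comp1_nucleus_l by metis
  show "inv\<^bsub>BijGroup Q\<^esub> f \<in> comp1 (nucleus_l Q mul)" if "f \<in> comp1 (nucleus_l Q mul)" for f
    using that autotopies_inv[OF Q] inv_one_BijGroup
    unfolding mem_comp1_nucleus_l by metis
qed

lemma subgroup_comp1_nucleus_m:
  assumes Q: "is_quasigroup Q mul"
  shows "subgroup (comp1 (nucleus_m Q mul)) (BijGroup Q)"
proof (rule subgroup_BijGroupI)
  show "comp1 (nucleus_m Q mul) \<subseteq> Bij Q"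
    by (auto simp: mem_comp1_nucleus_m autotopies_def)
  show "\<one>\<^bsub>BijGroup Q\<^esub> \<in> comp1 (nucleus_m Q mul)"
    using autotopies_one[OF Q] by (auto simp: mem_comp1_nucleus_m)
  show "f \<otimes>\<^bsub>BijGroup Q\<^esub> g \<in> comp1 (nucleus_m Q mul)"
    if "f \<in> comp1 (nucleus_m Q mul)" "g \<in> comp1 (nucleus_m Q mul)" for f g
    using that autotopies_mult[OF Q] one_mult_one_BijGroup
    unfolding mem_comp1_nucleus_m by metis
  show "inv\<^bsub>BijGroup Q\<^esub> f \<in> comp1 (nucleus_m Q mul)" if "f \<in> comp1 (nucleus_m Q mul)" for f
    using that autotopies_inv[OF Q] inv_one_BijGroup
    unfolding mem_comp1_nucleus_m by metis
qed

text \<open>Setting \<open>y = e\<close> in \<open>\<alpha> x \<cdot> y = \<gamma> (x \<cdot> y)\<close> shows \<open>\<alpha> = \<gamma>\<close>.\<close>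

lemma comp1_nucleus_l_apply:
  assumes loop: "is_loop Q mul" and \<alpha>: "\<alpha> \<in> comp1 (nucleus_l Q mul)"
    and xy: "x \<in> Q" "y \<in> Q"
  shows "mul (\<alpha> x) y = \<alpha> (mul x y)"
proof -
  have Q: "is_quasigroup Q mul" using loop by (simp add: is_loop_def)
  obtain e where e: "e \<in> Q" "\<And>x. x \<in> Q \<Longrightarrow> mul x e = x"
    using loop by (auto simp: is_loop_def)
  obtain \<gamma> where "(\<alpha>, \<one>\<^bsub>BijGroup Q\<^esub>, \<gamma>) \<in> autotopies Q mul"
    using \<alpha> by (auto simp: mem_comp1_nucleus_l)
  then have B: "\<alpha> \<in> Bij Q"
    and aut: "\<And>x y. x \<in> Q \<Longrightarrow> y \<in> Q \<Longrightarrow> mul (\<alpha> x) y = \<gamma> (mul x y)"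
    by (auto simp: autotopies_def one_BijGroup_apply)
  have "\<alpha> z = \<gamma> z" if "z \<in> Q" for z
    using aut[OF that e(1)] e(2) Bij_closed[OF B] that by simp
  then show ?thesis using aut[OF xy] quasigroup_closed[OF Q xy] by simp
qed

text \<open>If \<open>(\<alpha>, \<beta>, \<epsilon>)\<close> and \<open>(\<delta>, \<alpha>, \<epsilon>)\<close> are autotopies, then \<open>\<alpha> x \<cdot> y = x \<cdot> \<beta>\<inverse> y\<close> and
  \<open>x \<cdot> \<alpha> y = \<delta>\<inverse> x \<cdot> y\<close>. Evaluating both at the identity element \<open>e\<close> gives
  \<open>\<alpha> y = \<alpha> e \<cdot> y = \<beta>\<inverse> y\<close>.\<close>

lemma comp12_nucleus_m_apply:
  assumes loop: "is_loop Q mul"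
    and \<alpha>: "\<alpha> \<in> comp1 (nucleus_m Q mul) \<inter> comp2 (nucleus_m Q mul)"
    and xy: "x \<in> Q" "y \<in> Q"
  shows "mul (\<alpha> x) y = mul x (\<alpha> y)"
proof -
  have Q: "is_quasigroup Q mul" using loop by (simp add: is_loop_def)
  obtain e where e: "e \<in> Q" "\<And>x. x \<in> Q \<Longrightarrow> mul x e = x" "\<And>x. x \<in> Q \<Longrightarrow> mul e x = x"
    using loop by (auto simp: is_loop_def)
  obtain \<beta> where "(\<alpha>, \<beta>, \<one>\<^bsub>BijGroup Q\<^esub>) \<in> autotopies Q mul"
    using \<alpha> by (auto simp: mem_comp1_nucleus_m)
  then have B: "\<alpha> \<in> Bij Q" "\<beta> \<in> Bij Q"
    and aut: "\<And>x y. x \<in> Q \<Longrightarrow> y \<in> Q \<Longrightarrow> mul (\<alpha> x) (\<beta> y) = mul x y"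
    by (auto simp: autotopies_def one_BijGroup_apply quasigroup_closed[OF Q])
  obtain \<delta> where "(\<delta>, \<alpha>, \<one>\<^bsub>BijGroup Q\<^esub>) \<in> autotopies Q mul"
    using \<alpha> by (auto simp: mem_comp2_iff nucleus_m_def)
  then have D: "\<delta> \<in> Bij Q"
    and aut': "\<And>x y. x \<in> Q \<Longrightarrow> y \<in> Q \<Longrightarrow> mul (\<delta> x) (\<alpha> y) = mul x y"
    by (auto simp: autotopies_def one_BijGroup_apply quasigroup_closed[OF Q])
  let ?\<beta>' = "inv\<^bsub>BijGroup Q\<^esub> \<beta>" and ?\<delta>' = "inv\<^bsub>BijGroup Q\<^esub> \<delta>"
  have \<beta>': "mul (\<alpha> u) v = mul u (?\<beta>' v)" if "u \<in> Q" "v \<in> Q" for u v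
    using aut[of u "?\<beta>' v"] that BijGroup_apply_inv[OF B(2)]
      Bij_closed[OF inv_BijGroup_mem[OF B(2)]] by metis
  have \<delta>': "mul u (\<alpha> v) = mul (?\<delta>' u) v" if "u \<in> Q" "v \<in> Q" for u v
    using aut'[of "?\<delta>' u" v] that BijGroup_apply_inv[OF D]
      Bij_closed[OF inv_BijGroup_mem[OF D]] by metis
  have "\<alpha> e = ?\<delta>' e"
    using \<delta>'[OF e(1) e(1)] e Bij_closed[OF B(1)] Bij_closed[OF inv_BijGroup_mem[OF D]] by metis
  then have "\<alpha> y = mul (\<alpha> e) y"
    using \<delta>'[OF e(1) xy(2)] e(3) Bij_closed[OF B(1)] xy by metis
  also have "\<dots> = ?\<beta>' y"
    using \<beta>'[OF e(1) xy(2)] e(3) Bij_closed[OF inv_BijGroup_mem[OF B(2)]] xy by metis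
  finally show ?thesis using \<beta>'[OF xy] by simp
qed

section \<open>Orbit equivalences\<close>

lemma equiv_orbit_equiv:
  assumes "subgroup H (BijGroup Q)"
  shows "equiv Q (orbit_equiv Q H)"
proof -
  have HB: "H \<subseteq> Bij Q" using subgroup.subset[OF assms] by (simp add: carrier_BijGroup)
  show ?thesis
  proof (rule equivI)
    show "orbit_equiv Q H \<subseteq> Q \<times> Q" by (auto simp: orbit_equiv_def)
    show "refl_on Q (orbit_equiv Q H)"
    proof (rule refl_onI)
      show "(x, x) \<in> orbit_equiv Q H" if "x \<in> Q" for x
        using that subgroup.one_closed[OF assms] one_BijGroup_apply[OF that, symmetric]
        unfolding orbit_equiv_def by blast
    qed
    show "sym (orbit_equiv Q H)"
    proof (rule symI)
      fix x y assume "(x, y) \<in> orbit_equiv Q H"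
      then obtain \<alpha> where h: "x \<in> Q" "y \<in> Q" "\<alpha> \<in> H" "y = \<alpha> x"
        by (auto simp: orbit_equiv_def)
      then have "x = (inv\<^bsub>BijGroup Q\<^esub> \<alpha>) y" using BijGroup_inv_apply HB by (metis subsetD)
      then show "(y, x) \<in> orbit_equiv Q H"
        using h subgroup.m_inv_closed[OF assms] unfolding orbit_equiv_def by blast
    qed
    show "trans (orbit_equiv Q H)"
    proof (rule transI)
      fix x y z assume "(x, y) \<in> orbit_equiv Q H" "(y, z) \<in> orbit_equiv Q H"
      then obtain \<alpha> \<beta> where h: "x \<in> Q" "z \<in> Q" "\<alpha> \<in> H" "\<beta> \<in> H" "z = \<beta> (\<alpha> x)"
        by (auto simp: orbit_equiv_def)
      then have "z = (\<beta> \<otimes>\<^bsub>BijGroup Q\<^esub> \<alpha>) x"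
        using mult_BijGroup_apply HB by (metis subsetD)
      then show "(x, z) \<in> orbit_equiv Q H"
        using h subgroup.m_closed[OF assms] unfolding orbit_equiv_def by blast
    qed
  qed
qed

lemma right_invariant_orbit_equiv:
  assumes Q: "is_quasigroup Q mul" and HB: "H \<subseteq> Bij Q"
    and H: "\<And>\<alpha> x y. \<alpha> \<in> H \<Longrightarrow> x \<in> Q \<Longrightarrow> y \<in> Q \<Longrightarrow> mul (\<alpha> x) y = \<alpha> (mul x y)"
  shows "right_invariant Q mul (orbit_equiv Q H)"
  unfolding right_invariant_def
proof (intro ballI)
  fix x y z assume xyz: "x \<in> Q" "y \<in> Q" "z \<in> Q"
  have "y = \<alpha> x \<longleftrightarrow> mul y z = \<alpha> (mul x z)" if "\<alpha> \<in> H" for \<alpha>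
    using H[OF that] quasigroup_right_cancel[OF Q] Bij_closed HB that xyz by (metis subsetD)
  then show "(x, y) \<in> orbit_equiv Q H \<longleftrightarrow> (mul x z, mul y z) \<in> orbit_equiv Q H"
    using xyz quasigroup_closed[OF Q] by (auto simp: orbit_equiv_def)
qed

lemma left_invariant_orbit_equiv_if_right_invariant:
  assumes Q: "is_quasigroup Q mul" and HB: "H \<subseteq> Bij Q"
    and H: "\<And>\<alpha> x y. \<alpha> \<in> H \<Longrightarrow> x \<in> Q \<Longrightarrow> y \<in> Q \<Longrightarrow> mul (\<alpha> x) y = mul x (\<alpha> y)"
    and r: "right_invariant Q mul (orbit_equiv Q H)"
  shows "right_invariant Q (\<lambda>x y. mul y x) (orbit_equiv Q H)"
  unfolding right_invariant_def
proof (intro ballI)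
  fix x y z assume xyz: "x \<in> Q" "y \<in> Q" "z \<in> Q"
  then obtain z' where z': "z' \<in> Q" "mul z' x = mul z y"
    using Q quasigroup_closed quasigroup_right_division by metis
  have "z' = \<alpha> z \<longleftrightarrow> y = \<alpha> x" if "\<alpha> \<in> H" for \<alpha>
    using H[OF that, of z x] quasigroup_right_cancel[OF Q] quasigroup_left_cancel[OF Q]
      Bij_closed HB that xyz z' by (metis subsetD)
  then have "(x, y) \<in> orbit_equiv Q H \<longleftrightarrow> (z, z') \<in> orbit_equiv Q H"
    using xyz z' by (auto simp: orbit_equiv_def)
  also have "\<dots> \<longleftrightarrow> (mul z x, mul z' x) \<in> orbit_equiv Q H"
    using r xyz z' unfolding right_invariant_def by blast
  finally show "(x, y) \<in> orbit_equiv Q H \<longleftrightarrow> (mul z x, mul z y) \<in> orbit_equiv Q H"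
    by (simp add: z')
qed

section \<open>Normality of the orbit equivalences\<close>

lemma normal_congruence_opposite:
  "normal_congruence Q (\<lambda>x y. mul y x) \<theta> \<longleftrightarrow> normal_congruence Q mul \<theta>"
  by (auto simp: normal_congruence_iff)

lemma loop_opposite: "is_loop Q mul \<Longrightarrow> is_loop Q (\<lambda>x y. mul y x)"
  using quasigroup_opposite[of Q mul] by (auto simp: is_loop_def)

text \<open>The first alternative of the last hypothesis is invariance under left multiplication.\<close>

lemma nucleus_l_normal_congruence:
  assumes loop: "is_loop Q mul"
    and H: "subgroup H (BijGroup Q\<lparr>carrier := comp1 (nucleus_l Q mul)\<rparr>)"
    and adm: "right_invariant Q (\<lambda>x y. mul y x) (orbit_equiv Q H) \<or>
              division_invariant Q mul (orbit_equiv Q H)"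
  shows "normal_congruence Q mul (orbit_equiv Q H)"
proof -
  have Q: "is_quasigroup Q mul" using loop by (simp add: is_loop_def)
  have HG: "subgroup H (BijGroup Q)"
    using group.incl_subgroup[OF group_BijGroup subgroup_comp1_nucleus_l[OF Q] H] .
  have "H \<subseteq> comp1 (nucleus_l Q mul)" using subgroup.subset[OF H] by simp
  then have "right_invariant Q mul (orbit_equiv Q H)"
    using comp1_nucleus_l_apply[OF loop] subgroup.subset[OF HG]
    by (intro right_invariant_orbit_equiv[OF Q]) (auto simp: carrier_BijGroup)
  then show ?thesis
    using adm equiv_orbit_equiv[OF HG] left_invariant_if_division_invariant[OF Q]
    unfolding normal_congruence_iff by blast
qed

lemma nucleus_m_normal_congruence:
  assumes loop: "is_loop Q mul"
    and H: "subgroup H (BijGroup Q\<lparr>carrier := comp1 (nucleus_m Q mul) \<inter> comp2 (nucleus_m Q mul)\<rparr>)"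
    and r: "right_invariant Q mul (orbit_equiv Q H)"
  shows "normal_congruence Q mul (orbit_equiv Q H)"
proof -
  have Q: "is_quasigroup Q mul" using loop by (simp add: is_loop_def)
  have "subgroup (comp1 (nucleus_m Q mul) \<inter> comp2 (nucleus_m Q mul)) (BijGroup Q)"
    unfolding comp2_nucleus_m_eq[of Q mul]
    by (intro group.subgroups_Inter_pair group_BijGroup
        subgroup_comp1_nucleus_m[OF Q] subgroup_comp1_nucleus_m[OF quasigroup_opposite[OF Q]])
  then have HG: "subgroup H (BijGroup Q)"
    using group.incl_subgroup[OF group_BijGroup _ H] by blast
  have "H \<subseteq> comp1 (nucleus_m Q mul) \<inter> comp2 (nucleus_m Q mul)"
    using subgroup.subset[OF H] by simp
  then have "mul (\<alpha> x) y = mul x (\<alpha> y)" if "\<alpha> \<in> H" "x \<in> Q" "y \<in> Q" for \<alpha> x y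
    using comp12_nucleus_m_apply[OF loop _ that(2,3)] that(1) by blast
  moreover have "H \<subseteq> Bij Q" using subgroup.subset[OF HG] by (simp add: carrier_BijGroup)
  ultimately have "right_invariant Q (\<lambda>x y. mul y x) (orbit_equiv Q H)"
    using left_invariant_orbit_equiv_if_right_invariant[OF Q] r by blast
  then show ?thesis
    using r equiv_orbit_equiv[OF HG] unfolding normal_congruence_iff by blast
qed

theorem theorem4p29:
  fixes Q :: "'a set" and mul :: "'a \<Rightarrow> 'a \<Rightarrow> 'a"
  assumes "is_loop Q mul"
  shows "(\<forall>H. subgroup H (BijGroup Q\<lparr>carrier := comp1 (nucleus_l Q mul)\<rparr>) \<longrightarrow>
        ((\<forall>x\<in>Q. admissible Q (orbit_equiv Q H) (left_trans Q mul x) \<and>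
               admissible Q (orbit_equiv Q H) (inv\<^bsub>BijGroup Q\<^esub> (left_trans Q mul x)))
          \<longrightarrow> normal_congruence Q mul (orbit_equiv Q H)) \<and>
        ((\<forall>x\<in>Q. admissible Q (orbit_equiv Q H) (middle_trans Q mul x) \<and>
               admissible Q (orbit_equiv Q H) (inv\<^bsub>BijGroup Q\<^esub> (middle_trans Q mul x)))
          \<longrightarrow> normal_congruence Q mul (orbit_equiv Q H))) \<and>
     (\<forall>H. subgroup H (BijGroup Q\<lparr>carrier := comp2 (nucleus_r Q mul)\<rparr>) \<longrightarrow>
        ((\<forall>x\<in>Q. admissible Q (orbit_equiv Q H) (right_trans Q mul x) \<and>
               admissible Q (orbit_equiv Q H) (inv\<^bsub>BijGroup Q\<^esub> (right_trans Q mul x)))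
          \<longrightarrow> normal_congruence Q mul (orbit_equiv Q H)) \<and>
        ((\<forall>x\<in>Q. admissible Q (orbit_equiv Q H) (middle_trans Q mul x) \<and>
               admissible Q (orbit_equiv Q H) (inv\<^bsub>BijGroup Q\<^esub> (middle_trans Q mul x)))
          \<longrightarrow> normal_congruence Q mul (orbit_equiv Q H))) \<and>
     (\<forall>H. subgroup H (BijGroup Q\<lparr>carrier := comp1 (nucleus_m Q mul) \<inter> comp2 (nucleus_m Q mul)\<rparr>) \<longrightarrow>
        ((\<forall>x\<in>Q. admissible Q (orbit_equiv Q H) (right_trans Q mul x) \<and>
               admissible Q (orbit_equiv Q H) (inv\<^bsub>BijGroup Q\<^esub> (right_trans Q mul x)))
          \<longrightarrow> normal_congruence Q mul (orbit_equiv Q H)) \<and>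
        ((\<forall>x\<in>Q. admissible Q (orbit_equiv Q H) (left_trans Q mul x) \<and>
               admissible Q (orbit_equiv Q H) (inv\<^bsub>BijGroup Q\<^esub> (left_trans Q mul x)))
          \<longrightarrow> normal_congruence Q mul (orbit_equiv Q H)))"
proof (intro conjI allI impI)
  have Q: "is_quasigroup Q mul" using assms by (simp add: is_loop_def)
  {
    fix H assume H: "subgroup H (BijGroup Q\<lparr>carrier := comp1 (nucleus_l Q mul)\<rparr>)"
    note N = nucleus_l_normal_congruence[OF assms H]
    show "normal_congruence Q mul (orbit_equiv Q H)"
      if "\<forall>x\<in>Q. admissible Q (orbit_equiv Q H) (left_trans Q mul x) \<and>
               admissible Q (orbit_equiv Q H) (inv\<^bsub>BijGroup Q\<^esub> (left_trans Q mul x))"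
      using N left_invariant_if_admissible[OF Q] that by blast
    show "normal_congruence Q mul (orbit_equiv Q H)"
      if "\<forall>x\<in>Q. admissible Q (orbit_equiv Q H) (middle_trans Q mul x) \<and>
               admissible Q (orbit_equiv Q H) (inv\<^bsub>BijGroup Q\<^esub> (middle_trans Q mul x))"
      using N division_invariant_if_admissible[OF Q] that by blast
  next
    fix H assume "subgroup H (BijGroup Q\<lparr>carrier := comp2 (nucleus_r Q mul)\<rparr>)"
    note N = nucleus_l_normal_congruence[OF loop_opposite[OF assms]
        this[unfolded comp2_nucleus_r_eq], THEN normal_congruence_opposite[THEN iffD1]]
    show "normal_congruence Q mul (orbit_equiv Q H)"
      if "\<forall>x\<in>Q. admissible Q (orbit_equiv Q H) (right_trans Q mul x) \<and>
               admissible Q (orbit_equiv Q H) (inv\<^bsub>BijGroup Q\<^esub> (right_trans Q mul x))"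
      using N right_invariant_if_admissible[OF Q] that by blast
    show "normal_congruence Q mul (orbit_equiv Q H)"
      if "\<forall>x\<in>Q. admissible Q (orbit_equiv Q H) (middle_trans Q mul x) \<and>
               admissible Q (orbit_equiv Q H) (inv\<^bsub>BijGroup Q\<^esub> (middle_trans Q mul x))"
      using N division_invariant_opposite[OF division_invariant_if_admissible[OF Q]] that by blast
  next
    fix H
    assume H: "subgroup H (BijGroup Q\<lparr>carrier := comp1 (nucleus_m Q mul) \<inter> comp2 (nucleus_m Q mul)\<rparr>)"
    show "normal_congruence Q mul (orbit_equiv Q H)"
      if "\<forall>x\<in>Q. admissible Q (orbit_equiv Q H) (right_trans Q mul x) \<and>
               admissible Q (orbit_equiv Q H) (inv\<^bsub>BijGroup Q\<^esub> (right_trans Q mul x))"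
      using nucleus_m_normal_congruence[OF assms H] right_invariant_if_admissible[OF Q] that by blast
    have "comp1 (nucleus_m Q mul) \<inter> comp2 (nucleus_m Q mul) =
        comp1 (nucleus_m Q (\<lambda>x y. mul y x)) \<inter> comp2 (nucleus_m Q (\<lambda>x y. mul y x))"
      using comp2_nucleus_m_eq[of Q mul] comp2_nucleus_m_eq[of Q "\<lambda>x y. mul y x"] by auto
    note N = nucleus_m_normal_congruence[OF loop_opposite[OF assms] H[unfolded this],
        THEN normal_congruence_opposite[THEN iffD1]]
    show "normal_congruence Q mul (orbit_equiv Q H)"
      if "\<forall>x\<in>Q. admissible Q (orbit_equiv Q H) (left_trans Q mul x) \<and>
               admissible Q (orbit_equiv Q H) (inv\<^bsub>BijGroup Q\<^esub> (left_trans Q mul x))"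
      using N left_invariant_if_admissible[OF Q] that by blast
  }
qed

end
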